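(* Let $G=(U,W,E)$ be a finite bipartite graph with $W\neq\emptyset$, let $d_u\geq 0$ be real numbers for $u\in U$, and let $\boldsymbol{a}^v=(a^v_e)_{e\in\delta(v)}\in\mathbb{R}_{>0}^{\delta(v)}$ be given for every vertex $v\in U\cup W$. Let $$X^{\boldsymbol{a}}=\{\boldsymbol{x}\in\mathbb{R}_{\geq 0}^E\colon \boldsymbol{a}^u\cdot\boldsymbol{x}_{\delta(u)}=d_u\ \ \forall u\in U\},$$ and for $\boldsymbol{x}\in X^{\boldsymbol{a}}$ let $\ell^{\max}(\boldsymbol{x})=\max_{w\in W}\boldsymbol{a}^w\cdot\boldsymbol{x}_{\delta(w)}$ and $\ell^{\min}(\boldsymbol{x})=\min_{w\in W}\boldsymbol{a}^w\cdot\boldsymbol{x}_{\delta(w)}$. Suppose that $\ell^{\max}(\boldsymbol{x})>\ell^{\min}(\boldsymbol{x})$ for all $\boldsymbol{x}\in X^{\boldsymbol{a}}$. Then every $\boldsymbol{x}\in X^{\boldsymbol{a}}$ that minimizes $\ell^{\max}(\cdot)-\ell^{\min}(\cdot)$ over $X^{\boldsymbol{a}}$ also minimizes $\ell^{\max}(\cdot)$ over $X^{\boldsymbol{a}}$ and maximizes $\ell^{\min}(\cdot)$ over $X^{\boldsymbol{a}}$.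
   Context: A bipartite graph $G=(U,W,E)$ has vertex set the disjoint union of $U$ and $W$, and every edge in $E$ joins a vertex of $U$ to a vertex of $W$. For a vertex $v$, $\delta(v)\subseteq E$ is the set of edges incident to $v$. For $\boldsymbol{x}\in\mathbb{R}^E$ and $A\subseteq E$, $\boldsymbol{x}_A=(x_e)_{e\in A}$. The dot denotes the standard inner product, so $\boldsymbol{a}^v\cdot\boldsymbol{x}_{\delta(v)}=\sum_{e\in\delta(v)}a^v_e x_e$ (an empty sum is $0$). *)

theory Defs
  imports Complex_Main "HOL-Library.FuncSet"
begin

(* An edge is the two-element set of its end vertices. *)
definition bipartite_graph :: "'v set \<Rightarrow> 'v set \<Rightarrow> 'v set set \<Rightarrow> bool" where
  "bipartite_graph U W E \<longleftrightarrow> U \<inter> W = {} \<and> (\<forall>e\<in>E. \<exists>u\<in>U. \<exists>w\<in>W. e = {u, w})"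

definition incident_edges :: "'v set set \<Rightarrow> 'v \<Rightarrow> 'v set set" where
  "incident_edges E v = {e \<in> E. v \<in> e}"

(* The inner product of a^v and x restricted to the edges at v; a v e stands for a^v_e and
   is only ever read for edges e incident to v. *)
definition load :: "'v set set \<Rightarrow> ('v \<Rightarrow> 'v set \<Rightarrow> real) \<Rightarrow> ('v set \<Rightarrow> real) \<Rightarrow> 'v \<Rightarrow> real" where
  "load E a x v = (\<Sum>e\<in>incident_edges E v. a v e * x e)"

(* Nonnegative vectors indexed by E are the extensional functions on E, so that
   distinct members of the set are distinct vectors. *)
definition feasible ::
  "'v set \<Rightarrow> 'v set set \<Rightarrow> ('v \<Rightarrow> 'v set \<Rightarrow> real) \<Rightarrow> ('v \<Rightarrow> real) \<Rightarrow> ('v set \<Rightarrow> real) set" where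
  "feasible U E a d = {x \<in> E \<rightarrow>\<^sub>E {0..}. \<forall>u\<in>U. load E a x u = d u}"

definition lmax ::
  "'v set \<Rightarrow> 'v set set \<Rightarrow> ('v \<Rightarrow> 'v set \<Rightarrow> real) \<Rightarrow> ('v set \<Rightarrow> real) \<Rightarrow> real" where
  "lmax W E a x = (MAX w\<in>W. load E a x w)"

definition lmin ::
  "'v set \<Rightarrow> 'v set set \<Rightarrow> ('v \<Rightarrow> 'v set \<Rightarrow> real) \<Rightarrow> ('v set \<Rightarrow> real) \<Rightarrow> real" where
  "lmin W E a x = (MIN w\<in>W. load E a x w)"

end

(* Let x minimize the gap and suppose that some feasible y has a smaller maximum. Read z = y - x as
   a flow that leaves w along e = {u, w} if z_e < 0 and enters w if z_e > 0; it is conserved at every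
   u in U. Keep only the part of this flow that starts in the set S of vertices of maximum load:
   delete the outflow of the vertices outside S and scale what leaves u down accordingly. Then the
   loads on S still decrease and no other load decreases. Since the two extremes are distinct, a
   short step in this direction lowers the maximum and does not lower the minimum, so the gap was
   not minimal. The minimum is treated in the same way with -z. *)

theory Submission
  imports Defs
begin

lemma bipartite_left_end:
  assumes "bipartite_graph U W E" "e \<in> E" "u \<in> U" "u \<in> e"
  shows "(THE v. v \<in> U \<inter> e) = u"
  using assms unfolding bipartite_graph_def by (intro the_equality) auto

text \<open>An edge has exactly one end in \<open>W\<close>, so it can meet \<open>S\<close> only
  there. This makes the truncation below all-or-nothing at each vertex of \<open>W\<close>.\<close>

lemma bipartite_edge_meets:
  assumes "bipartite_graph U W E" "S \<subseteq> W" "w \<in> W" "e \<in> incident_edges E w"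
  shows "e \<inter> S \<noteq> {} \<longleftrightarrow> w \<in> S"
  using assms unfolding bipartite_graph_def incident_edges_def by fastforce

lemma load_affine:
  "load E a (\<lambda>e. x e + c * y e) v = load E a x v + c * load E a y v"
  unfolding load_def by (simp add: algebra_simps sum.distrib sum_distrib_left)

lemma load_diff: "load E a (\<lambda>e. x e - y e) v = load E a x v - load E a y v"
  using load_affine[of E a x "-1" y v] by simp

lemma load_uminus: "load E a (\<lambda>e. - x e) v = - load E a x v"
  unfolding load_def by (simp add: sum_negf)

text \<open>Feasible vectors are extensional, whereas sums such as x + t z are not; restricting them
  back to \<open>E\<close> costs nothing.\<close>

lemma load_restrict: "load E a (restrict x E) v = load E a x v"
  unfolding load_def incident_edges_def by (intro sum.cong) auto

text \<open>Every entry of \<open>z'\<close> lies between 0 and that of \<open>z\<close>. Hence, for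
  z = y - x, the vector x + z' stays between x and y and so nonnegative. Applied with y - x for the
  maximum and x - y for the minimum.\<close>

lemma conformal_truncation:
  fixes z :: "'v set \<Rightarrow> real"
  assumes bip: "bipartite_graph U W E"
    and pos: "\<forall>v\<in>U \<union> W. \<forall>e\<in>incident_edges E v. a v e > 0"
    and bal: "\<forall>u\<in>U. load E a z u = 0" and S: "S \<subseteq> W"
  obtains z' where "\<forall>u\<in>U. load E a z' u = 0"
    and "\<forall>e\<in>E. min 0 (z e) \<le> z' e \<and> z' e \<le> max 0 (z e)"
    and "\<forall>w\<in>S. load E a z' w \<le> load E a z w"
    and "\<forall>w\<in>W - S. 0 \<le> load E a z' w"
proof -
  \<comment> \<open>\<open>n\<close> is the flow leaving \<open>W\<close>, \<open>k\<close> the part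
    of it that starts in \<open>S\<close>, and \<open>s u\<close> the fraction of the weighted
    inflow at \<open>u\<close> that survives.\<close>
  define n where "n e = max 0 (- z e)" for e
  define k where "k e = (if e \<inter> S \<noteq> {} then n e else 0)" for e
  define s where "s u = load E a k u / load E a n u" for u
  define end_U where "end_U e = (THE v. v \<in> U \<inter> e)" for e
  define z' where "z' e = s (end_U e) * max 0 (z e) - k e" for e
  have k_le: "0 \<le> k e" "k e \<le> n e" for e
    by (auto simp: k_def n_def)
  have s01: "0 \<le> s u" "s u \<le> 1" and s_mult: "s u * load E a n u = load E a k u"
    if "u \<in> U" for u
  proof -
    have *: "0 \<le> a u e * k e" "a u e * k e \<le> a u e * n e" if "e \<in> incident_edges E u" for e
      using pos \<open>u \<in> U\<close> that k_le
      by (simp_all add: less_imp_le mult_left_mono)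
    have "0 \<le> load E a k u" "load E a k u \<le> load E a n u"
      unfolding load_def by (intro sum_nonneg sum_mono *; assumption)+
    \<comment> \<open>If \<open>load E a n u\<close> is 0, the quotient \<open>s u\<close> is 0 by
      convention, and \<open>load E a k u\<close> is squeezed to 0 as well, so the product formula
      still holds.\<close>
    then show "0 \<le> s u" "s u \<le> 1" "s u * load E a n u = load E a k u"
      unfolding s_def by (auto simp: divide_le_eq_1)
  qed
  have end_U: "end_U e \<in> U" if e: "e \<in> E" for e
  proof -
    obtain u w where "u \<in> U" "e = {u, w}"
      using bip e unfolding bipartite_graph_def by meson
    then show ?thesis
      using bipartite_left_end[OF bip e, of u] unfolding end_U_def by simp
  qed
  have balanced: "load E a z' u = 0" if u: "u \<in> U" for u
  proof -
    have "load E a z' u = load E a (\<lambda>e. s u * (z e + n e) - k e) u"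
      unfolding load_def
    proof (rule sum.cong)
      fix e assume "e \<in> incident_edges E u"
      then have "end_U e = u"
        using bipartite_left_end[OF bip _ u] unfolding end_U_def incident_edges_def by simp
      \<comment> \<open>Writing the positive part as z + n lets the balance of \<open>z\<close> at
        \<open>u\<close> show that its load equals that of \<open>n\<close>; the factor
        \<open>s u\<close> then turns it into the load of \<open>k\<close>.\<close>
      moreover have "max 0 (z e) = z e + n e"
        by (simp add: n_def max_def)
      ultimately show "a u e * z' e = a u e * (s u * (z e + n e) - k e)"
        by (simp add: z'_def)
    qed simp
    also have "\<dots> = s u * (load E a z u + load E a n u) - load E a k u"
      unfolding load_def
      by (simp add: algebra_simps sum.distrib sum_subtractf sum_distrib_left)
    also have "\<dots> = 0"
      using bal u s_mult[OF u] by simp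
    finally show ?thesis .
  qed
  have scaled: "0 \<le> s (end_U e) * max 0 (z e)" "s (end_U e) * max 0 (z e) \<le> max 0 (z e)"
    if "e \<in> E" for e
    using s01[OF end_U[OF that]] by (auto intro: mult_left_le_one_le)
  have conformal: "min 0 (z e) \<le> z' e \<and> z' e \<le> max 0 (z e)" if "e \<in> E" for e
    using scaled[OF that] k_le[of e] unfolding z'_def n_def by linarith
  have decrease: "load E a z' w \<le> load E a z w" if "w \<in> S" for w
    unfolding load_def
  proof (rule sum_mono)
    fix e assume e: "e \<in> incident_edges E w"
    \<comment> \<open>At a vertex of \<open>S\<close> the outflow is kept whole and the inflow is
      multiplied by at most 1, so the comparison holds edge by edge.\<close>
    then have "k e = n e" "e \<in> E"
      using that unfolding k_def incident_edges_def by auto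
    then have "z' e \<le> z e"
      using scaled[of e] unfolding z'_def n_def by linarith
    then show "a w e * z' e \<le> a w e * z e"
      using pos e that S by (meson UnI2 less_imp_le mult_left_mono subsetD)
  qed
  have increase: "0 \<le> load E a z' w" if "w \<in> W - S" for w
    unfolding load_def
  proof (rule sum_nonneg)
    fix e assume e: "e \<in> incident_edges E w"
    then have "k e = 0" "e \<in> E"
      using that bipartite_edge_meets[OF bip S _ e] unfolding k_def incident_edges_def by auto
    then have "0 \<le> z' e"
      using scaled[of e] unfolding z'_def by linarith
    then show "0 \<le> a w e * z' e"
      using pos e that by (simp add: less_imp_le)
  qed
  show thesis
    using that balanced conformal decrease increase by blast
qed

text \<open>Since y is nonnegative, the lower bound on \<open>z\<close> gives z \<ge> -x on every
  edge, so x + z is nonnegative and, by convexity, so is x + t z.\<close>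

lemma feasible_step:
  assumes x: "x \<in> feasible U E a d" and y: "y \<in> feasible U E a d"
    and bal: "\<forall>u\<in>U. load E a z u = 0"
    and conf: "\<forall>e\<in>E. min 0 (y e - x e) \<le> z e"
    and t: "0 \<le> t" "t \<le> 1"
  shows "restrict (\<lambda>e. x e + t * z e) E \<in> feasible U E a d"
proof -
  have "0 \<le> x e + t * z e" if e: "e \<in> E" for e
  proof -
    have xy: "0 \<le> x e" "0 \<le> y e"
      using x y e unfolding feasible_def by auto
    then have "- x e \<le> z e"
      using conf e by fastforce
    then have "t * (- x e) \<le> t * z e"
      using t by (intro mult_left_mono)
    moreover have "t * x e \<le> x e"
      using t xy by (simp add: mult_left_le_one_le)
    ultimately show ?thesis
      by simp
  qed
  moreover have "load E a (restrict (\<lambda>e. x e + t * z e) E) u = d u" if "u \<in> U" for u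
    using x bal that unfolding load_restrict load_affine feasible_def by simp
  ultimately show ?thesis
    unfolding feasible_def by auto
qed

text \<open>Where f = hi, any t > 0 gives the upper bound because g < 0, and continuity gives the
  lower one thanks to lo < hi. Elsewhere the roles are exchanged. As \<open>W\<close> is finite, one
  small t serves all vertices.\<close>

lemma short_step:
  fixes f g :: "'v \<Rightarrow> real"
  assumes "finite W" "lo < hi"
    and f: "\<forall>w\<in>W. lo \<le> f w \<and> f w \<le> hi"
    and top: "\<forall>w\<in>W. f w = hi \<longrightarrow> g w < 0"
    and other: "\<forall>w\<in>W. f w \<noteq> hi \<longrightarrow> 0 \<le> g w"
  obtains t where "0 < t" "t \<le> 1" "\<forall>w\<in>W. lo \<le> f w + t * g w \<and> f w + t * g w < hi"
proof -
  have "eventually (\<lambda>t. lo \<le> f w + t * g w \<and> f w + t * g w < hi) (at_right 0)"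
    if w: "w \<in> W" for w
  proof (cases "f w = hi")
    case True
    have lim: "((\<lambda>t. f w + t * g w) \<longlongrightarrow> f w + 0 * g w) (at_right 0)"
      by (intro tendsto_intros)
    have "eventually (\<lambda>t. lo < f w + t * g w) (at_right 0)"
      using order_tendstoD(1)[OF lim] True \<open>lo < hi\<close> by simp
    moreover have "eventually (\<lambda>t::real. 0 < t) (at_right 0)"
      by (simp add: eventually_at_right_less)
    ultimately show ?thesis
      by eventually_elim (use True top w in \<open>auto simp: mult_pos_neg\<close>)
  next
    case False
    have lim: "((\<lambda>t. f w + t * g w) \<longlongrightarrow> f w + 0 * g w) (at_right 0)"
      by (intro tendsto_intros)
    have "eventually (\<lambda>t. f w + t * g w < hi) (at_right 0)"
      using order_tendstoD(2)[OF lim] False f w by force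
    moreover have "eventually (\<lambda>t::real. 0 < t) (at_right 0)"
      by (simp add: eventually_at_right_less)
    ultimately show ?thesis
      by eventually_elim (use False other f w in \<open>auto simp: add_increasing2\<close>)
  qed
  then have "eventually (\<lambda>t. \<forall>w\<in>W. lo \<le> f w + t * g w \<and> f w + t * g w < hi) (at_right 0)"
    using \<open>finite W\<close> by (simp add: eventually_ball_finite)
  moreover have "eventually (\<lambda>t::real. 0 < t) (at_right 0)"
    by (simp add: eventually_at_right_less)
  moreover have "eventually (\<lambda>t::real. t < 1) (at_right 0)"
    by (rule order_tendstoD(2)[OF tendsto_ident_at]) simp
  ultimately have "eventually (\<lambda>t. (\<forall>w\<in>W. lo \<le> f w + t * g w \<and> f w + t * g w < hi)
      \<and> 0 < t \<and> t < 1) (at_right 0)"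
    by eventually_elim simp
  then obtain t where "\<forall>w\<in>W. lo \<le> f w + t * g w \<and> f w + t * g w < hi" "0 < t" "t < 1"
    using eventually_happens by force
  then show thesis
    using that[of t] by simp
qed

lemma lower_max:
  assumes bip: "bipartite_graph U W E" and finW: "finite W"
    and ne: "W \<noteq> {}"
    and pos: "\<forall>v\<in>U \<union> W. \<forall>e\<in>incident_edges E v. a v e > 0"
    and x: "x \<in> feasible U E a d" and y: "y \<in> feasible U E a d"
    and gap: "lmin W E a x < lmax W E a x" and less: "lmax W E a y < lmax W E a x"
  shows "\<exists>x'\<in>feasible U E a d. lmax W E a x' < lmax W E a x \<and> lmin W E a x \<le> lmin W E a x'"
proof -
  define S where "S = {w \<in> W. load E a x w = lmax W E a x}"
  have bal: "\<forall>u\<in>U. load E a (\<lambda>e. y e - x e) u = 0"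
    using x y by (simp add: load_diff feasible_def)
  obtain z where z: "\<forall>u\<in>U. load E a z u = 0"
    "\<forall>e\<in>E. min 0 (y e - x e) \<le> z e \<and> z e \<le> max 0 (y e - x e)"
    "\<forall>w\<in>S. load E a z w \<le> load E a (\<lambda>e. y e - x e) w" "\<forall>w\<in>W - S. 0 \<le> load E a z w"
    by (rule conformal_truncation[OF bip pos bal, of S])
      (auto simp: S_def)
  have bounds: "\<forall>w\<in>W. lmin W E a x \<le> load E a x w \<and> load E a x w \<le> lmax W E a x"
    using finW by (simp add: lmin_def lmax_def)
  \<comment> \<open>On \<open>S\<close> the load of \<open>z\<close> is at most load y - load x,
    hence at most lmax y - lmax x < 0.\<close>
  have top: "\<forall>w\<in>W. load E a x w = lmax W E a x \<longrightarrow> load E a z w < 0"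
  proof (intro ballI impI)
    fix w assume w: "w \<in> W" "load E a x w = lmax W E a x"
    then have "load E a y w \<le> lmax W E a y"
      using finW by (simp add: lmax_def)
    then show "load E a z w < 0"
      using z(3) w less by (fastforce simp: S_def load_diff)
  qed
  obtain t where t: "0 < t" "t \<le> 1"
    "\<forall>w\<in>W. lmin W E a x \<le> load E a x w + t * load E a z w \<and>
       load E a x w + t * load E a z w < lmax W E a x"
    by (rule short_step[OF finW gap bounds top]) (use z(4) in \<open>auto simp: S_def\<close>)
  define x' where "x' = restrict (\<lambda>e. x e + t * z e) E"
  have "x' \<in> feasible U E a d"
    unfolding x'_def using z t by (intro feasible_step[OF x y]) auto
  moreover have "\<forall>w\<in>W. lmin W E a x \<le> load E a x' w \<and> load E a x' w < lmax W E a x"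
    using t(3) unfolding x'_def load_restrict load_affine .
  then have "lmax W E a x' < lmax W E a x" "lmin W E a x \<le> lmin W E a x'"
    using finW ne by (simp_all add: lmax_def[of W E a x'] lmin_def[of W E a x'])
  ultimately show ?thesis
    by blast
qed

text \<open>Negating the loads turns the minimum into a maximum: the short step is taken between
  -lmax and -lmin, with \<open>z\<close> conformal to x - y.\<close>

lemma raise_min:
  assumes bip: "bipartite_graph U W E" and finW: "finite W"
    and ne: "W \<noteq> {}"
    and pos: "\<forall>v\<in>U \<union> W. \<forall>e\<in>incident_edges E v. a v e > 0"
    and x: "x \<in> feasible U E a d" and y: "y \<in> feasible U E a d"
    and gap: "lmin W E a x < lmax W E a x" and less: "lmin W E a x < lmin W E a y"
  shows "\<exists>x'\<in>feasible U E a d. lmax W E a x' \<le> lmax W E a x \<and> lmin W E a x < lmin W E a x'"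
proof -
  define S where "S = {w \<in> W. load E a x w = lmin W E a x}"
  have bal: "\<forall>u\<in>U. load E a (\<lambda>e. x e - y e) u = 0"
    using x y by (simp add: load_diff feasible_def)
  obtain z where z: "\<forall>u\<in>U. load E a z u = 0"
    "\<forall>e\<in>E. min 0 (x e - y e) \<le> z e \<and> z e \<le> max 0 (x e - y e)"
    "\<forall>w\<in>S. load E a z w \<le> load E a (\<lambda>e. x e - y e) w" "\<forall>w\<in>W - S. 0 \<le> load E a z w"
    by (rule conformal_truncation[OF bip pos bal, of S])
      (auto simp: S_def)
  have bounds: "\<forall>w\<in>W. - lmax W E a x \<le> - load E a x w \<and> - load E a x w \<le> - lmin W E a x"
    using finW by (simp add: lmin_def lmax_def)
  have bot: "\<forall>w\<in>W. - load E a x w = - lmin W E a x \<longrightarrow> load E a z w < 0"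
  proof (intro ballI impI)
    fix w assume w: "w \<in> W" "- load E a x w = - lmin W E a x"
    then have "lmin W E a y \<le> load E a y w"
      using finW by (simp add: lmin_def)
    then show "load E a z w < 0"
      using z(3) w less by (fastforce simp: S_def load_diff)
  qed
  have gap': "- lmax W E a x < - lmin W E a x"
    using gap by simp
  obtain t where t: "0 < t" "t \<le> 1"
    "\<forall>w\<in>W. - lmax W E a x \<le> - load E a x w + t * load E a z w \<and>
       - load E a x w + t * load E a z w < - lmin W E a x"
    by (rule short_step[OF finW gap' bounds bot]) (use z(4) in \<open>auto simp: S_def\<close>)
  \<comment> \<open>\<open>z\<close> describes the change of the negated loads, so x moves along -z.
    The upper half of the conformality of \<open>z\<close> becomes the lower bound that
    \<open>feasible_step\<close> asks of -z.\<close>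
  define x' where "x' = restrict (\<lambda>e. x e + t * - z e) E"
  have "x' \<in> feasible U E a d"
    unfolding x'_def using z(1,2) t
    by (intro feasible_step[OF x y]) (force simp: load_uminus)+
  moreover have "\<forall>w\<in>W. lmin W E a x < load E a x' w \<and> load E a x' w \<le> lmax W E a x"
    using t(3) unfolding x'_def load_restrict load_affine load_uminus by force
  then have "lmax W E a x' \<le> lmax W E a x" "lmin W E a x < lmin W E a x'"
    using finW ne by (simp_all add: lmax_def[of W E a x'] lmin_def[of W E a x'])
  ultimately show ?thesis
    by blast
qed

theorem theorem1p2:
  fixes U W :: "'v set"
    and E :: "'v set set"
    and a :: "'v \<Rightarrow> 'v set \<Rightarrow> real"
    and d :: "'v \<Rightarrow> real"
  assumes "bipartite_graph U W E"
    and "finite U" and "finite W" and "W \<noteq> {}"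
    and "\<forall>u\<in>U. d u \<ge> 0"
    and "\<forall>v\<in>U \<union> W. \<forall>e\<in>incident_edges E v. a v e > 0"
    and "\<forall>x\<in>feasible U E a d. lmax W E a x > lmin W E a x"
  shows "\<forall>x. is_arg_min (\<lambda>y. lmax W E a y - lmin W E a y) (\<lambda>y. y \<in> feasible U E a d) x \<longrightarrow>
           is_arg_min (lmax W E a) (\<lambda>y. y \<in> feasible U E a d) x \<and>
           is_arg_max (lmin W E a) (\<lambda>y. y \<in> feasible U E a d) x"
proof (intro allI impI)
  fix x
  assume "is_arg_min (\<lambda>y. lmax W E a y - lmin W E a y) (\<lambda>y. y \<in> feasible U E a d) x"
  then have x: "x \<in> feasible U E a d"
    and least: "\<And>y. y \<in> feasible U E a d \<Longrightarrow>
      lmax W E a x - lmin W E a x \<le> lmax W E a y - lmin W E a y"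
    by (auto simp: is_arg_min_linorder)
  have gap: "lmin W E a x < lmax W E a x"
    using assms(7) x by blast
  \<comment> \<open>A better y would yield a feasible vector improving one extreme strictly without
    worsening the other, hence one with a smaller gap than x.\<close>
  have "\<not> lmax W E a y < lmax W E a x" if "y \<in> feasible U E a d" for y
    using lower_max[OF assms(1,3,4,6) x that gap] least by fastforce
  moreover have "\<not> lmin W E a x < lmin W E a y" if "y \<in> feasible U E a d" for y
    using raise_min[OF assms(1,3,4,6) x that gap] least by fastforce
  ultimately show "is_arg_min (lmax W E a) (\<lambda>y. y \<in> feasible U E a d) x \<and>
      is_arg_max (lmin W E a) (\<lambda>y. y \<in> feasible U E a d) x"
    using x unfolding is_arg_min_def is_arg_max_def by blast
qed

end
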